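(* Let $R$ be a commutative ring with unity. Suppose every non-Jacobson element of $R$ is contained in only finitely many maximal ideals. Let $k\in\mathbb{N}$ and let $I_0,\ldots,I_k$ be mutually co-maximal ideals of $R$. Moreover, if exactly one of the ideals $I_0,\ldots,I_k$ is a proper ideal, suppose that this ideal is contained in only finitely many maximal ideals. Let $m^i_j\in\mathbb{N}$ for $0\le i,j\le k$. Then the map $$SL_{k+1}(R)\longrightarrow\prod_{i=0}^{k}\mathbb{PF}^{k,(m^i_0,m^i_1,\ldots,m^i_k)}_{I_i}$$ given by $$[a_{i,j}]_{0\le i,j\le k}\longmapsto\big([a_{0,0}:a_{0,1}:\cdots:a_{0,k}],[a_{1,0}:a_{1,1}:\cdots:a_{1,k}],\ldots,[a_{k,0}:a_{k,1}:\cdots:a_{k,k}]\big)$$ is surjective. In particular, let $I_0,\ldots,I_k$ be pairwise co-maximal ideals of $R$ such that for each $0\le i\le k$ either $I_i=R$ or $I_i=Q_{i1}Q_{i2}\cdots Q_{ir_i}$, where the $Q_{ij}$ are ideals with $\mathrm{rad}(Q_{ij})=M_{ij}$ and the $M_{ij}$ ($1\le j\le r_i$, $0\le i\le k$) are distinct maximal ideals of $R$. Then the map $SL_{k+1}(R)\to\prod_{i=0}^{k}\mathbb{PF}^{k,(m^i_0,\ldots,m^i_k)}_{I_i}$ given by the same formula is surjective.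
   Context: $\mathbb{N}$ denotes the positive integers. Ideals are mutually (pairwise) co-maximal if any two with distinct indices sum to $R$; the unit ideal $R$ is allowed. A non-Jacobson element of $R$ is an element not in the Jacobson radical of $R$ (the intersection of all maximal ideals). For $k\in\mathbb{N}$, let $\mathcal{GCD}_{k+1}(R)=\{(a_0,\ldots,a_k)\in R^{k+1} : \sum_{i=0}^{k}(a_i)=R\}$. For a proper ideal $I\subsetneq R$ and $m_0,\ldots,m_k\in\mathbb{N}$, define an equivalence relation on $\mathcal{GCD}_{k+1}(R)$ by $(a_0,\ldots,a_k)\sim(b_0,\ldots,b_k)$ iff there is $\lambda\in R$ whose image in $R/I$ is a unit such that $a_i\equiv\lambda^{m_i}b_i\bmod I$ for all $0\le i\le k$. If $I=R$, any two elements are declared equivalent. The generalized projective space $\mathbb{PF}^{k,(m_0,\ldots,m_k)}_{I}$ is the quotient set of $\mathcal{GCD}_{k+1}(R)$ by this relation (a singleton if $I=R$); the class of $(a_0,\ldots,a_k)$ is written $[a_0:\cdots:a_k]$. $SL_{k+1}(R)$ is the group of $(k+1)\times(k+1)$ matrices over $R$ with determinant $1$. *)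

theory Defs
  imports "HOL-Algebra.Algebra" "HOL-Combinatorics.Permutations"
begin

definition jacobson_radical :: "('a, 'b) ring_scheme \<Rightarrow> 'a set" where
  \<comment> \<open>The intersection with the carrier matters only for the zero ring, which has no maximal ideals.\<close>
  "jacobson_radical R = carrier R \<inter> \<Inter> {M. maximalideal M R}"

definition ideal_radical :: "('a, 'b) ring_scheme \<Rightarrow> 'a set \<Rightarrow> 'a set" where
  "ideal_radical R I = {x \<in> carrier R. \<exists>n::nat. n \<ge> 1 \<and> x [^]\<^bsub>R\<^esub> n \<in> I}"

definition comaximal :: "('a, 'b) ring_scheme \<Rightarrow> 'a set \<Rightarrow> 'a set \<Rightarrow> bool" where
  "comaximal R I J \<longleftrightarrow> I <+>\<^bsub>R\<^esub> J = carrier R"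

text \<open>
  Tuples of length \<open>n\<close> are extensional functions on \<open>{..<n}\<close>, and square matrices are tuples of
  rows, so that \<open>A i j\<close> is the entry in row \<open>i\<close> and column \<open>j\<close> and \<open>A i\<close> is row \<open>i\<close>.
  The determinant is given by the Leibniz formula.
\<close>

definition determinant :: "('a, 'b) ring_scheme \<Rightarrow> nat \<Rightarrow> (nat \<Rightarrow> nat \<Rightarrow> 'a) \<Rightarrow> 'a" where
  "determinant R n A =
     (\<Oplus>\<^bsub>R\<^esub>p\<in>{p. p permutes {..<n}}.
        if evenperm p then \<Otimes>\<^bsub>R\<^esub>i\<in>{..<n}. A i (p i)
        else \<ominus>\<^bsub>R\<^esub> (\<Otimes>\<^bsub>R\<^esub>i\<in>{..<n}. A i (p i)))"

definition SL :: "('a, 'b) ring_scheme \<Rightarrow> nat \<Rightarrow> (nat \<Rightarrow> nat \<Rightarrow> 'a) set" where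
  "SL R n = {A \<in> {..<n} \<rightarrow>\<^sub>E ({..<n} \<rightarrow>\<^sub>E carrier R). determinant R n A = \<one>\<^bsub>R\<^esub>}"

text \<open>Sums and products of finitely many ideals are taken in the semiring \<^const>\<open>ideals_set\<close>.\<close>

definition GCD_tuples :: "('a, 'b) ring_scheme \<Rightarrow> nat \<Rightarrow> (nat \<Rightarrow> 'a) set" where
  "GCD_tuples R n =
     {a \<in> {..<n} \<rightarrow>\<^sub>E carrier R. (\<Oplus>\<^bsub>ideals_set R\<^esub>i\<in>{..<n}. PIdl\<^bsub>R\<^esub> (a i)) = carrier R}"

definition PF_rel ::
    "('a, 'b) ring_scheme \<Rightarrow> nat \<Rightarrow> (nat \<Rightarrow> nat) \<Rightarrow> 'a set \<Rightarrow> ((nat \<Rightarrow> 'a) \<times> (nat \<Rightarrow> 'a)) set" where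
  "PF_rel R k m I =
     {(a, b). a \<in> GCD_tuples R (k + 1) \<and> b \<in> GCD_tuples R (k + 1) \<and>
        (I = carrier R \<or>
         (\<exists>l\<in>carrier R. I +>\<^bsub>R\<^esub> l \<in> Units (R Quot I) \<and>
            (\<forall>i\<le>k. a i \<ominus>\<^bsub>R\<^esub> (l [^]\<^bsub>R\<^esub> m i \<otimes>\<^bsub>R\<^esub> b i) \<in> I)))}"

definition PF :: "('a, 'b) ring_scheme \<Rightarrow> nat \<Rightarrow> (nat \<Rightarrow> nat) \<Rightarrow> 'a set \<Rightarrow> (nat \<Rightarrow> 'a) set set" where
  "PF R k m I = GCD_tuples R (k + 1) // PF_rel R k m I"

definition PF_class ::
    "('a, 'b) ring_scheme \<Rightarrow> nat \<Rightarrow> (nat \<Rightarrow> nat) \<Rightarrow> 'a set \<Rightarrow> (nat \<Rightarrow> 'a) \<Rightarrow> (nat \<Rightarrow> 'a) set" where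
  "PF_class R k m I a = PF_rel R k m I `` {a}"

definition SL_to_PF ::
    "('a, 'b) ring_scheme \<Rightarrow> nat \<Rightarrow> (nat \<Rightarrow> nat \<Rightarrow> nat) \<Rightarrow> (nat \<Rightarrow> 'a set) \<Rightarrow>
      (nat \<Rightarrow> nat \<Rightarrow> 'a) \<Rightarrow> (nat \<Rightarrow> (nat \<Rightarrow> 'a) set)" where
  "SL_to_PF R k m I = (\<lambda>A\<in>SL R (k + 1). \<lambda>i\<in>{..k}. PF_class R k (m i) (I i) (A i))"

end

theory Submission
  imports Defs
begin

text \<open>
  Every target tuple is hit with all scaling units equal to \<open>1\<close>: given unimodular rows \<open>b\<^sub>0, \<dots>, b\<^sub>k\<close>,
  there is a matrix of determinant \<open>1\<close> whose row \<open>i\<close> is congruent to \<open>b\<^sub>i\<close> modulo \<open>I\<^sub>i\<close>.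

  The hypotheses serve to make each \<open>I\<^sub>i\<close> lie in only finitely many maximal ideals. If \<open>I\<^sub>i\<close> and \<open>I\<^sub>j\<close>
  are proper and comaximal, write \<open>1 = x + y\<close> with \<open>x\<close> in \<open>I\<^sub>i\<close> and \<open>y\<close> in \<open>I\<^sub>j\<close>; a maximal ideal over
  \<open>I\<^sub>j\<close> cannot contain \<open>x\<close>, so \<open>x\<close> is a non-Jacobson element, and it lies in every maximal ideal over
  \<open>I\<^sub>i\<close> (\<open>finite_maximalideals_over_comaximal\<close>). A single proper ideal has the property by assumption.
  In the second form of the theorem, a maximal ideal over a product of the \<open>Q\<^sub>i\<^sub>j\<close> contains a factor and
  hence equals the radical of that factor (\<open>finite_maximalideals_over_product\<close>).

  Thus each \<open>R / I\<^sub>i\<close> is semilocal. A semilocal ring has stable rank one (\<open>semilocal_stable_range\<close>), so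
  elementary column operations turn the unimodular row \<open>b\<^sub>i\<close> into the \<open>i\<close>-th unit vector modulo \<open>I\<^sub>i\<close>
  (\<open>col_reachable_unit_row\<close>). By the Chinese remainder theorem the rows can be treated independently:
  if the multiplier of a column operation is scaled by an element \<open>e\<close> that is \<open>1\<close> modulo \<open>I\<^sub>i\<close> and lies
  in every other \<open>I\<^sub>j\<close>, then the operation changes only row \<open>i\<close>, up to the congruences
  (\<open>col_reachable_row_add\<close>). So the matrix with rows \<open>b\<^sub>i\<close> becomes congruent to the identity. Column
  operations are reversible and preserve the determinant; applying the reversed operations to the
  identity matrix itself gives the required matrix (\<open>exists_determinant_one_lift\<close>).
\<close>

section \<open>Column operations and the Leibniz determinant\<close>

definition col_add :: "('a, 'b) ring_scheme \<Rightarrow> nat \<Rightarrow> nat \<Rightarrow> 'a \<Rightarrow> (nat \<Rightarrow> nat \<Rightarrow> 'a) \<Rightarrow> nat \<Rightarrow> nat \<Rightarrow> 'a" where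
  "col_add R p q x A = (\<lambda>r. (A r)(q := A r q \<oplus>\<^bsub>R\<^esub> x \<otimes>\<^bsub>R\<^esub> A r p))"

definition unit_matrix :: "('a, 'b) ring_scheme \<Rightarrow> nat \<Rightarrow> nat \<Rightarrow> 'a" where
  "unit_matrix R = (\<lambda>r c. if r = c then \<one>\<^bsub>R\<^esub> else \<zero>\<^bsub>R\<^esub>)"

definition square_matrix :: "('a, 'b) ring_scheme \<Rightarrow> nat \<Rightarrow> (nat \<Rightarrow> nat \<Rightarrow> 'a) \<Rightarrow> bool" where
  "square_matrix R n A \<longleftrightarrow> (\<forall>r<n. \<forall>c<n. A r c \<in> carrier R)"

context cring
begin

lemma square_matrixD [simp]:
  "square_matrix R n A \<Longrightarrow> r < n \<Longrightarrow> c < n \<Longrightarrow> A r c \<in> carrier R"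
  by (simp add: square_matrix_def)

lemma square_matrix_col_add:
  assumes "square_matrix R n A" "p < n" "x \<in> carrier R"
  shows "square_matrix R n (col_add R p q x A)"
  using assms by (auto simp: square_matrix_def col_add_def)

lemma square_matrix_perm:
  assumes "square_matrix R n A" "\<pi> permutes {..<n}" "i < n"
  shows "A i (\<pi> i) \<in> carrier R"
  using assms permutes_in_image[of \<pi> "{..<n}" i] by simp

lemma determinant_cong:
  assumes "\<And>r c. r < n \<Longrightarrow> c < n \<Longrightarrow> A r c = B r c" "square_matrix R n B"
  shows "determinant R n A = determinant R n B"
proof -
  have *: "(\<Otimes>i\<in>{..<n}. A i (\<pi> i)) = (\<Otimes>i\<in>{..<n}. B i (\<pi> i))" if s: "\<pi> permutes {..<n}" for \<pi>
  proof (rule finprod_cong')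
    show "(\<lambda>i. B i (\<pi> i)) \<in> {..<n} \<rightarrow> carrier R"
      using square_matrix_perm[OF assms(2) s] by auto
    fix i assume "i \<in> {..<n}"
    then show "A i (\<pi> i) = B i (\<pi> i)"
      using assms(1)[of i "\<pi> i"] permutes_in_image[OF s, of i] by simp
  qed simp
  have c: "(\<Otimes>i\<in>{..<n}. B i (\<pi> i)) \<in> carrier R" if s: "\<pi> permutes {..<n}" for \<pi>
    using square_matrix_perm[OF assms(2) s] by (intro finprod_closed) auto
  show ?thesis unfolding determinant_def
    by (rule finsum_cong') (auto simp: * c)
qed

text \<open>
  Composition with the transposition \<open>transpose p q\<close> is a bijection from the even onto the odd
  permutations, and it preserves the product of entries because columns \<open>p\<close> and \<open>q\<close> agree. Hence the
  terms of the Leibniz formula cancel in pairs. Deducing the claim from antisymmetry alone would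
  only give that twice the determinant vanishes.
\<close>

lemma determinant_equal_columns:
  assumes A: "square_matrix R n A" and pq: "p < n" "q < n" "p \<noteq> q"
    and eq: "\<And>r. r < n \<Longrightarrow> A r p = A r q"
  shows "determinant R n A = \<zero>"
proof -
  define P where "P \<pi> = (\<Otimes>i\<in>{..<n}. A i (\<pi> i))" for \<pi>
  define E where "E = {\<pi>. \<pi> permutes {..<n} \<and> evenperm \<pi>}"
  define sw :: "(nat \<Rightarrow> nat) \<Rightarrow> nat \<Rightarrow> nat" where "sw = (\<lambda>\<pi>. transpose p q \<circ> \<pi>)"
  have fin: "finite {\<pi>. \<pi> permutes {..<n}}" by (simp add: finite_permutations)
  have finE: "finite E" unfolding E_def by (rule finite_subset[OF _ fin]) auto
  have P: "P \<pi> \<in> carrier R" if "\<pi> permutes {..<n}" for \<pi>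
    unfolding P_def using square_matrix_perm[OF A that] by (intro finprod_closed) auto
  have perm: "permutation \<pi>" if "\<pi> permutes {..<n}" for \<pi>
    using that permutation_permutes by blast
  have tp: "transpose p q permutes {..<n}" using pq by (intro permutes_swap_id) auto
  have sw_perm: "sw \<pi> permutes {..<n}" if "\<pi> permutes {..<n}" for \<pi>
    unfolding sw_def using permutes_compose[OF that tp] .
  have sw_even: "evenperm (sw \<pi>) \<longleftrightarrow> \<not> evenperm \<pi>" if "\<pi> permutes {..<n}" for \<pi>
    unfolding sw_def using perm[OF tp] perm[OF that] pq by (simp add: evenperm_comp evenperm_swap)
  have sw_sw: "sw (sw \<pi>) = \<pi>" for \<pi> by (auto simp: sw_def fun_eq_iff)
  have sw_P: "P (sw \<pi>) = P \<pi>" if s: "\<pi> permutes {..<n}" for \<pi>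
    unfolding P_def
  proof (rule finprod_cong')
    show "(\<lambda>i. A i (\<pi> i)) \<in> {..<n} \<rightarrow> carrier R" using square_matrix_perm[OF A s] by auto
    fix i assume "i \<in> {..<n}"
    then show "A i (sw \<pi> i) = A i (\<pi> i)"
      using eq[of i] by (auto simp: sw_def transpose_def)
  qed simp
  have union: "{\<pi>. \<pi> permutes {..<n}} = E \<union> sw ` E"
  proof (intro equalityI subsetI)
    fix \<pi> assume "\<pi> \<in> {\<pi>. \<pi> permutes {..<n}}"
    then have s: "\<pi> permutes {..<n}" by simp
    show "\<pi> \<in> E \<union> sw ` E"
    proof (cases "evenperm \<pi>")
      case True then show ?thesis using s by (simp add: E_def)
    next
      case False
      then have "sw \<pi> \<in> E" using s sw_perm sw_even by (simp add: E_def)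
      then have "sw (sw \<pi>) \<in> sw ` E" by (rule imageI)
      then show ?thesis by (simp add: sw_sw)
    qed
  next
    fix \<pi> assume "\<pi> \<in> E \<union> sw ` E"
    then show "\<pi> \<in> {\<pi>. \<pi> permutes {..<n}}" using sw_perm by (auto simp: E_def)
  qed
  have inj: "inj_on sw E" by (rule inj_on_inverseI[of _ sw]) (rule sw_sw)
  define t where "t \<pi> = (if evenperm \<pi> then P \<pi> else \<ominus> P \<pi>)" for \<pi>
  have t: "t \<pi> \<in> carrier R" if "\<pi> permutes {..<n}" for \<pi> using P[OF that] by (simp add: t_def)
  have "determinant R n A = (\<Oplus>\<pi>\<in>E \<union> sw ` E. t \<pi>)"
    unfolding determinant_def union t_def P_def ..
  also have "\<dots> = (\<Oplus>\<pi>\<in>E. t \<pi>) \<oplus> (\<Oplus>\<pi>\<in>sw ` E. t \<pi>)"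
  proof (rule finsum_Un_disjoint)
    show "E \<inter> sw ` E = {}" using sw_even by (auto simp: E_def)
  qed (use finE t sw_perm in \<open>auto simp: E_def\<close>)
  also have "(\<Oplus>\<pi>\<in>sw ` E. t \<pi>) = (\<Oplus>\<pi>\<in>E. t (sw \<pi>))"
    by (rule finsum_reindex) (use inj t sw_perm in \<open>auto simp: E_def\<close>)
  also have "(\<Oplus>\<pi>\<in>E. t \<pi>) \<oplus> (\<Oplus>\<pi>\<in>E. t (sw \<pi>)) = (\<Oplus>\<pi>\<in>E. t \<pi> \<oplus> t (sw \<pi>))"
    by (rule finsum_addf[symmetric]) (use t sw_perm in \<open>auto simp: E_def\<close>)
  also have "\<dots> = \<zero>"
    by (rule add.finprod_one_eqI) (use sw_even sw_P P in \<open>auto simp: t_def E_def r_neg\<close>)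
  finally show ?thesis .
qed

text \<open>
  By linearity in column \<open>q\<close> the determinant changes by \<open>x\<close> times the determinant of the matrix in
  which column \<open>q\<close> is replaced by column \<open>p\<close>; this matrix has two equal columns.
\<close>

lemma determinant_col_add:
  assumes A: "square_matrix R n A" and pq: "p < n" "q < n" "p \<noteq> q" and x: "x \<in> carrier R"
  shows "determinant R n (col_add R p q x A) = determinant R n A"
proof -
  define B where "B = (\<lambda>r. (A r)(q := A r p))"
  have B: "square_matrix R n B" using A pq by (auto simp: B_def square_matrix_def)
  define P where "P C \<pi> = (\<Otimes>i\<in>{..<n}. C i (\<pi> i))" for C :: "nat \<Rightarrow> nat \<Rightarrow> 'a" and \<pi>
  define t where "t C \<pi> = (if evenperm \<pi> then P C \<pi> else \<ominus> P C \<pi>)"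
    for C :: "nat \<Rightarrow> nat \<Rightarrow> 'a" and \<pi>
  have det: "determinant R n C = (\<Oplus>\<pi>\<in>{\<pi>. \<pi> permutes {..<n}}. t C \<pi>)" for C
    unfolding determinant_def t_def P_def ..
  have fin: "finite {\<pi>. \<pi> permutes {..<n}}" by (simp add: finite_permutations)
  have P: "P C \<pi> \<in> carrier R" if "\<pi> permutes {..<n}" "square_matrix R n C" for \<pi> C
    unfolding P_def using square_matrix_perm[OF that(2,1)] by (intro finprod_closed) auto
  have t: "t C \<pi> \<in> carrier R" if "\<pi> permutes {..<n}" "square_matrix R n C" for \<pi> C
    using P[OF that] by (simp add: t_def)
  have Pc: "P (col_add R p q x A) \<pi> = P A \<pi> \<oplus> x \<otimes> P B \<pi>" if s: "\<pi> permutes {..<n}" for \<pi>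
  proof -
    \<comment> \<open>Row \<open>j\<close> is the only one whose factor is taken from column \<open>q\<close>.\<close>
    obtain j where j: "j < n" "\<pi> j = q"
      using permutes_image[OF s] pq(2) by (metis imageE lessThan_iff)
    have other: "\<pi> i \<noteq> q" if "i \<noteq> j" for i
      using that j(2) permutes_inj[OF s] by (metis injD)
    define N where "N = {..<n} - {j}"
    have n: "{..<n} = insert j N" using j by (auto simp: N_def)
    have N: "finite N" "j \<notin> N" "\<And>i. i \<in> N \<Longrightarrow> i < n \<and> i \<noteq> j" by (auto simp: N_def)
    have split: "P C \<pi> = C j q \<otimes> (\<Otimes>i\<in>N. C i (\<pi> i))" if C: "square_matrix R n C" for C
      unfolding P_def n using N square_matrix_perm[OF C s] j by (subst finprod_insert) auto
    have same: "(\<Otimes>i\<in>N. C i (\<pi> i)) = (\<Otimes>i\<in>N. A i (\<pi> i))" 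
      if "\<And>i c. c \<noteq> q \<Longrightarrow> C i c = A i c" for C
      by (rule finprod_cong') (use N square_matrix_perm[OF A s] other that in auto)
    define Z where "Z = (\<Otimes>i\<in>N. A i (\<pi> i))"
    have "P (col_add R p q x A) \<pi> = (A j q \<oplus> x \<otimes> A j p) \<otimes> Z"
      using split[OF square_matrix_col_add[OF A pq(1) x]] same[of "col_add R p q x A"]
      by (simp add: col_add_def Z_def)
    moreover have "P A \<pi> = A j q \<otimes> Z"
      using split[OF A] by (simp add: Z_def)
    moreover have "P B \<pi> = A j p \<otimes> Z"
      using split[OF B] same[of B] by (simp add: B_def Z_def)
    moreover have "Z \<in> carrier R"
      unfolding Z_def using N square_matrix_perm[OF A s] by (intro finprod_closed) auto
    moreover have "A j q \<in> carrier R" "A j p \<in> carrier R" using A pq j by auto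
    ultimately show ?thesis
      using x by (simp add: l_distr m_assoc)
  qed
  have tc: "t (col_add R p q x A) \<pi> = t A \<pi> \<oplus> x \<otimes> t B \<pi>" if s: "\<pi> permutes {..<n}" for \<pi>
    using P[OF s A] P[OF s B] x by (simp add: t_def Pc[OF s] minus_add r_minus)
  have "determinant R n (col_add R p q x A)
      = (\<Oplus>\<pi>\<in>{\<pi>. \<pi> permutes {..<n}}. t A \<pi> \<oplus> x \<otimes> t B \<pi>)"
    unfolding det by (rule finsum_cong') (use t A B x tc in auto)
  also have "\<dots> = determinant R n A \<oplus> (\<Oplus>\<pi>\<in>{\<pi>. \<pi> permutes {..<n}}. x \<otimes> t B \<pi>)"
    unfolding det by (rule finsum_addf) (use t A B x in auto)
  also have "(\<Oplus>\<pi>\<in>{\<pi>. \<pi> permutes {..<n}}. x \<otimes> t B \<pi>) = x \<otimes> determinant R n B"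
    unfolding det by (rule finsum_rdistr[symmetric]) (use fin t B x in auto)
  also have "determinant R n B = \<zero>"
    by (rule determinant_equal_columns[OF B pq]) (use pq in \<open>auto simp: B_def\<close>)
  finally show ?thesis
    using x t[OF _ A] by (simp add: det)
qed

lemma determinant_unit_matrix: "determinant R n (unit_matrix R) = \<one>"
proof -
  have U: "square_matrix R n (unit_matrix R)" by (simp add: square_matrix_def unit_matrix_def)
  define t where "t \<pi> = (if evenperm \<pi> then \<Otimes>i\<in>{..<n}. unit_matrix R i (\<pi> i)
      else \<ominus> (\<Otimes>i\<in>{..<n}. unit_matrix R i (\<pi> i)))" for \<pi>
  have zero: "(\<Otimes>i\<in>{..<n}. unit_matrix R i (\<pi> i)) = \<zero>" if s: "\<pi> permutes {..<n}" "\<pi> \<noteq> id" for \<pi>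
  proof -
    obtain j where j: "\<pi> j \<noteq> j" using s(2) by (auto simp: fun_eq_iff)
    then have jn: "j < n" using s(1) by (meson lessThan_iff permutes_not_in)
    define N where "N = {..<n} - {j}"
    have n: "{..<n} = insert j N" and N: "finite N" "j \<notin> N" "\<And>i. i \<in> N \<Longrightarrow> i < n"
      using jn by (auto simp: N_def)
    show ?thesis
      unfolding n using N j square_matrix_perm[OF U s(1)] jn
      by (subst finprod_insert) (auto simp: unit_matrix_def intro!: finprod_closed)
  qed
  have one: "(\<Otimes>i\<in>{..<n}. unit_matrix R i i) = \<one>"
    by (rule finprod_one_eqI) (simp add: unit_matrix_def)
  have "determinant R n (unit_matrix R) = (\<Oplus>\<pi>\<in>{\<pi>. \<pi> permutes {..<n}}. t \<pi>)"
    unfolding determinant_def t_def ..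
  also have "\<dots> = (\<Oplus>\<pi>\<in>{id}. t \<pi>)"
    by (rule add.finprod_mono_neutral_cong_right)
      (use zero one square_matrix_perm[OF U] in
        \<open>auto simp: t_def finite_permutations permutes_id intro!: finprod_closed a_inv_closed\<close>)
  also have "\<dots> = \<one>" by (simp add: t_def one)
  finally show ?thesis .
qed

end

section \<open>Maximal ideals and unimodular rows\<close>

context cring
begin

text \<open>
  Zorn's lemma applies because properness of an ideal means that \<open>\<one>\<close> is not an element, and this
  survives unions of chains.
\<close>

lemma exists_maximalideal:
  assumes J: "ideal J R" and proper: "J \<noteq> carrier R"
  shows "\<exists>M. maximalideal M R \<and> J \<subseteq> M"
proof -
  define S where "S = {K. ideal K R \<and> J \<subseteq> K \<and> \<one> \<notin> K}"
  have one: "\<one> \<notin> K \<longleftrightarrow> K \<noteq> carrier R" if "ideal K R" for K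
    using ideal.one_imp_carrier[OF that] by auto
  have "\<exists>M\<in>S. \<forall>K\<in>S. M \<subseteq> K \<longrightarrow> K = M"
  proof (rule subset_Zorn_nonempty)
    show "S \<noteq> {}" using J proper one by (auto simp: S_def)
    fix C assume C: "C \<noteq> {}" "subset.chain S C"
    then have CS: "C \<subseteq> S" by (simp add: subset.chain_def)
    then have "subset.chain {K. ideal K R} C"
      using C(2) by (auto simp: subset.chain_def S_def)
    then have "ideal (\<Union>C) R" using chain_Union_is_ideal[of C] C(1) by simp
    then show "\<Union>C \<in> S" using CS C(1) by (fastforce simp: S_def)
  qed
  then obtain M where M: "M \<in> S" "\<And>K. K \<in> S \<Longrightarrow> M \<subseteq> K \<Longrightarrow> K = M" by blast
  have "maximalideal M R"
  proof (rule maximalidealI)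
    show "ideal M R" "carrier R \<noteq> M" using M(1) by (auto simp: S_def)
    fix K assume K: "ideal K R" "M \<subseteq> K" "K \<subseteq> carrier R"
    show "K = M \<or> K = carrier R"
      using M K one[OF K(1)] by (auto simp: S_def)
  qed
  then show ?thesis using M(1) by (auto simp: S_def)
qed

lemma maximalideal_one: "maximalideal M R \<Longrightarrow> \<one> \<notin> M"
  using ideal.one_imp_carrier maximalideal.I_notcarr maximalideal.axioms(1) by blast

lemma subset_set_add:
  assumes "ideal J R" "ideal K R"
  shows "J \<subseteq> J <+>\<^bsub>R\<^esub> K" "K \<subseteq> J <+>\<^bsub>R\<^esub> K"
proof -
  interpret J: ideal J R by fact
  interpret K: ideal K R by fact
  show "J \<subseteq> J <+>\<^bsub>R\<^esub> K"
  proof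
    fix x assume x: "x \<in> J"
    then have "x = x \<oplus> \<zero>" using J.Icarr by simp
    then show "x \<in> J <+>\<^bsub>R\<^esub> K" using x K.zero_closed unfolding set_add_def' by blast
  qed
  show "K \<subseteq> J <+>\<^bsub>R\<^esub> K"
  proof
    fix x assume x: "x \<in> K"
    then have "x = \<zero> \<oplus> x" using K.Icarr by simp
    then show "x \<in> J <+>\<^bsub>R\<^esub> K" using x J.zero_closed unfolding set_add_def' by blast
  qed
qed

lemma unit_mod_ideal:
  assumes J: "ideal J R" and u: "u \<in> carrier R"
    and M: "\<And>M. maximalideal M R \<Longrightarrow> J \<subseteq> M \<Longrightarrow> u \<notin> M"
  shows "\<exists>w\<in>carrier R. J +> w \<otimes> u = J +> \<one>"
proof -
  interpret J: ideal J R by fact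
  have P: "ideal (PIdl u) R" using cgenideal_ideal[OF u] .
  interpret P: ideal "PIdl u" R by fact
  have K: "ideal (PIdl u <+>\<^bsub>R\<^esub> J) R" using add_ideals[OF P J] .
  have sub: "PIdl u \<subseteq> PIdl u <+>\<^bsub>R\<^esub> J" "J \<subseteq> PIdl u <+>\<^bsub>R\<^esub> J"
    using subset_set_add[OF P J] by auto
  have "PIdl u <+>\<^bsub>R\<^esub> J = carrier R"
  proof (rule ccontr)
    assume "PIdl u <+>\<^bsub>R\<^esub> J \<noteq> carrier R"
    then obtain M where "maximalideal M R" "PIdl u <+>\<^bsub>R\<^esub> J \<subseteq> M"
      using exists_maximalideal[OF K] by blast
    then show False using M sub cgenideal_self[OF u] by blast
  qed
  then obtain w z where wz: "w \<in> carrier R" "z \<in> J" "\<one> = w \<otimes> u \<oplus> z"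
    using one_closed unfolding set_add_def' cgenideal_def by blast
  have z: "z \<in> carrier R" using wz(2) J.Icarr by blast
  have "w \<otimes> u \<ominus> \<one> = \<ominus> z"
    unfolding wz(3) using wz(1) u z by algebra
  then have "w \<otimes> u \<ominus> \<one> \<in> J" using wz(2) by simp
  then show ?thesis
    using quotient_eq_iff_same_a_r_cos[OF J, of "w \<otimes> u" \<one>] wz(1) u by auto
qed

text \<open>
  No maximal ideal \<open>N \<noteq> M\<close> is contained in \<open>M\<close>; since \<open>M\<close> is prime, the product of one element of
  \<open>N - M\<close> for each \<open>N\<close> in \<open>T\<close> stays outside \<open>M\<close>.
\<close>

lemma maximalideal_avoid:
  assumes M: "maximalideal M R" and fin: "finite T"
    and T: "\<And>N. N \<in> T \<Longrightarrow> maximalideal N R" "M \<notin> T"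
  shows "\<exists>d\<in>carrier R. (\<forall>N\<in>T. d \<in> N) \<and> d \<notin> M"
  using fin T
proof (induction T)
  case empty
  then show ?case using maximalideal_one[OF M] by auto
next
  case (insert N T)
  then obtain d where d: "d \<in> carrier R" "\<forall>N\<in>T. d \<in> N" "d \<notin> M" by auto
  interpret M: primeideal M R using maximalideal_prime[OF M] .
  interpret N: maximalideal N R using insert.prems by auto
  have "\<not> N \<subseteq> M"
    using N.I_maximal[OF M.is_ideal] insert.prems(2) M.I_notcarr M.a_subset by auto
  then obtain y where y: "y \<in> N" "y \<notin> M" by blast
  have "y \<otimes> d \<notin> M" using M.I_prime[of y d] y d N.Icarr by auto
  moreover have "\<forall>N'\<in>insert N T. y \<otimes> d \<in> N'"
  proof
    fix N' assume N': "N' \<in> insert N T"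
    show "y \<otimes> d \<in> N'"
    proof (cases "N' = N")
      case True then show ?thesis using N.I_r_closed[OF y(1) d(1)] by simp
    next
      case False
      then have "ideal N' R" "d \<in> N'"
        using N' d insert.prems(1)[OF N'] maximalideal.axioms(1) by auto
      then show ?thesis using ideal.I_l_closed N.Icarr[OF y(1)] by metis
    qed
  qed
  ultimately show ?case using d y N.Icarr by blast
qed

lemma ideal_add_mem_iff:
  assumes "ideal J R" "x \<in> carrier R" "y \<in> J"
  shows "x \<oplus> y \<in> J \<longleftrightarrow> x \<in> J"
proof -
  interpret J: ideal J R by fact
  have "x = (x \<oplus> y) \<oplus> \<ominus> y" using assms(2) J.Icarr[OF assms(3)] by algebra
  then show ?thesis using assms(3) J.a_closed J.a_inv_closed by metis
qed

text \<open>
  Modulo the intersection of the finite set \<open>T\<close>, one element of the form \<open>a \<oplus> c \<otimes> b\<close> generates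
  the same ideal as \<open>a\<close> and \<open>b\<close> together. Only \<open>a \<oplus> c \<otimes> b \<in> M\<close> with \<open>b \<notin> M\<close> can go wrong for the next
  maximal ideal \<open>M\<close>; adding to \<open>c\<close> an element of all ideals treated so far that is not in \<open>M\<close> repairs
  this without disturbing them.
\<close>

lemma semilocal_stable_range:
  assumes fin: "finite T" and T: "\<And>M. M \<in> T \<Longrightarrow> maximalideal M R"
    and a: "a \<in> carrier R" and b: "b \<in> carrier R"
  shows "\<exists>c\<in>carrier R. \<forall>M\<in>T. a \<oplus> c \<otimes> b \<in> M \<longleftrightarrow> a \<in> M \<and> b \<in> M"
  using fin T
proof (induction T)
  case empty then show ?case by auto
next
  case (insert M T)
  then obtain c where c: "c \<in> carrier R" "\<forall>N\<in>T. a \<oplus> c \<otimes> b \<in> N \<longleftrightarrow> a \<in> N \<and> b \<in> N"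
    by auto
  interpret M: primeideal M R using maximalideal_prime insert.prems by auto
  show ?case
  proof (cases "a \<oplus> c \<otimes> b \<in> M \<longleftrightarrow> a \<in> M \<and> b \<in> M")
    case True then show ?thesis using c by auto
  next
    case False
    have b_mem: "a \<oplus> c \<otimes> b \<in> M \<longleftrightarrow> a \<in> M" if "b \<in> M"
      using ideal_add_mem_iff[OF M.is_ideal a] M.I_l_closed[OF that c(1)] by auto
    have bM: "b \<notin> M" using False b_mem by blast
    then have in_M: "a \<oplus> c \<otimes> b \<in> M" using False by auto
    obtain d where d: "d \<in> carrier R" "\<forall>N\<in>T. d \<in> N" "d \<notin> M"
      using maximalideal_avoid[of M T] insert by auto
    have eq: "a \<oplus> (c \<oplus> d) \<otimes> b = (a \<oplus> c \<otimes> b) \<oplus> d \<otimes> b"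
      using a b c d by algebra
    have "d \<otimes> b \<notin> M" using M.I_prime[OF d(1) b] d bM by blast
    then have "d \<otimes> b \<oplus> (a \<oplus> c \<otimes> b) \<notin> M"
      using ideal_add_mem_iff[OF M.is_ideal _ in_M, of "d \<otimes> b"] d b by simp
    then have 1: "a \<oplus> (c \<oplus> d) \<otimes> b \<notin> M"
      unfolding eq using a b c d by (simp add: a_comm)
    have 2: "a \<oplus> (c \<oplus> d) \<otimes> b \<in> N \<longleftrightarrow> a \<in> N \<and> b \<in> N" if N: "N \<in> T" for N
    proof -
      have "ideal N R" using insert.prems N maximalideal.axioms(1) by auto
      then show ?thesis
        unfolding eq using ideal_add_mem_iff[of N "a \<oplus> c \<otimes> b" "d \<otimes> b"] 
          ideal.I_r_closed[of N R d b] c d N a b by simp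
    qed
    show ?thesis using 1 2 bM c(1) d(1) by (intro bexI[of _ "c \<oplus> d"]) auto
  qed
qed

text \<open>
  The part of the Chinese remainder theorem that isolates one ideal: \<open>e\<close> is the product of elements
  of the \<open>K i\<close> that are congruent to \<open>\<one>\<close> modulo \<open>J\<close>.
\<close>

lemma comaximal_separate:
  assumes J: "ideal J R" and fin: "finite S"
    and K: "\<And>i. i \<in> S \<Longrightarrow> ideal (K i) R" "\<And>i. i \<in> S \<Longrightarrow> comaximal R J (K i)"
  shows "\<exists>e\<in>carrier R. J +> e = J +> \<one> \<and> (\<forall>i\<in>S. e \<in> K i)"
  using fin K
proof (induction S)
  case empty then show ?case by auto
next
  case (insert i S)
  then obtain e where e: "e \<in> carrier R" "J +> e = J +> \<one>" "\<forall>i\<in>S. e \<in> K i" by auto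
  interpret J: ideal J R by fact
  interpret K: ideal "K i" R using insert.prems by auto
  have "J <+>\<^bsub>R\<^esub> K i = carrier R" using insert.prems by (simp add: comaximal_def)
  then obtain z y where zy: "z \<in> J" "y \<in> K i" "\<one> = z \<oplus> y"
    using one_closed unfolding set_add_def' by blast
  have y: "y \<in> carrier R" and z: "z \<in> carrier R" using zy J.Icarr K.Icarr by auto
  have "y \<ominus> \<one> = \<ominus> z" unfolding zy(3) using y z by algebra
  then have "J +> y = J +> \<one>"
    using quotient_eq_iff_same_a_r_cos[OF J y one_closed] zy(1) by simp
  then have "J +> e \<otimes> y = J +> \<one> \<otimes> \<one>"
    using e y by (metis J.rcoset_mult_add one_closed)
  moreover have "e \<otimes> y \<in> K i" using K.I_l_closed zy e by blast
  moreover have "e \<otimes> y \<in> K j" if "j \<in> S" for j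
    using insert.prems(1)[of j] ideal.I_r_closed e that y by fastforce
  ultimately show ?case using e y by (intro bexI[of _ "e \<otimes> y"]) auto
qed

lemma ideals_set_simps [simp]:
  "carrier (ideals_set R) = {J. ideal J R}"
  "J \<oplus>\<^bsub>ideals_set R\<^esub> K = J <+>\<^bsub>R\<^esub> K" "\<zero>\<^bsub>ideals_set R\<^esub> = {\<zero>}"
  "J \<otimes>\<^bsub>ideals_set R\<^esub> K = J \<cdot> K" "\<one>\<^bsub>ideals_set R\<^esub> = carrier R"
  by (simp_all add: ideals_set_def)

lemma set_add_subset_iff:
  assumes "ideal J R" "ideal K R" "ideal L R"
  shows "J <+>\<^bsub>R\<^esub> K \<subseteq> L \<longleftrightarrow> J \<subseteq> L \<and> K \<subseteq> L"
proof -
  interpret J: ideal J R by fact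
  interpret K: ideal K R by fact
  interpret L: ideal L R by fact
  have "J \<subseteq> J <+>\<^bsub>R\<^esub> K" "K \<subseteq> J <+>\<^bsub>R\<^esub> K"
    using subset_set_add[OF assms(1,2)] by auto
  moreover have "J <+>\<^bsub>R\<^esub> K \<subseteq> L" if "J \<subseteq> L" "K \<subseteq> L"
    using that by (auto simp: set_add_def')
  ultimately show ?thesis by blast
qed

lemma ideals_sum:
  assumes "finite S" "\<And>i. i \<in> S \<Longrightarrow> ideal (f i) R"
  shows "ideal (\<Oplus>\<^bsub>ideals_set R\<^esub>i\<in>S. f i) R"
    and "ideal L R \<Longrightarrow> (\<Oplus>\<^bsub>ideals_set R\<^esub>i\<in>S. f i) \<subseteq> L \<longleftrightarrow> (\<forall>i\<in>S. f i \<subseteq> L)"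
proof -
  interpret S: semiring "ideals_set R" by (rule ideals_set_is_semiring)
  have 1: "ideal (\<Oplus>\<^bsub>ideals_set R\<^esub>i\<in>S. f i) R"
    if "\<And>i. i \<in> S \<Longrightarrow> ideal (f i) R" for S
    using S.finsum_closed[of f S] that by auto
  show "ideal (\<Oplus>\<^bsub>ideals_set R\<^esub>i\<in>S. f i) R" by (rule 1[OF assms(2)])
  assume L: "ideal L R"
  show "(\<Oplus>\<^bsub>ideals_set R\<^esub>i\<in>S. f i) \<subseteq> L \<longleftrightarrow> (\<forall>i\<in>S. f i \<subseteq> L)"
    using assms
  proof (induction S)
    case empty
    then show ?case using additive_subgroup.zero_closed[OF ideal.axioms(1)[OF L]] by simp
  next
    case (insert i S)
    then show ?case
      by (subst S.finsum_insert) (auto simp: set_add_subset_iff L 1)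
  qed
qed

text \<open>
  A criterion without explicit Bezout coefficients. The reduction of a row needs it for maximal \<open>L\<close>
  only; conversely, a row of a matrix of determinant \<open>\<one>\<close> passes it because an ideal that contains the
  row contains the determinant.
\<close>

lemma unimodular_iff:
  assumes "finite S" "\<And>i. i \<in> S \<Longrightarrow> a i \<in> carrier R"
  shows "(\<Oplus>\<^bsub>ideals_set R\<^esub>i\<in>S. PIdl (a i)) = carrier R \<longleftrightarrow>
    (\<forall>L. ideal L R \<longrightarrow> (\<forall>i\<in>S. a i \<in> L) \<longrightarrow> L = carrier R)"
proof -
  define s where "s = (\<Oplus>\<^bsub>ideals_set R\<^esub>i\<in>S. PIdl (a i))"
  have P: "ideal (PIdl (a i)) R" if "i \<in> S" for i using cgenideal_ideal assms(2)[OF that] .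
  have s: "ideal s R" unfolding s_def by (rule ideals_sum(1)[OF assms(1) P])
  have sub: "s \<subseteq> L \<longleftrightarrow> (\<forall>i\<in>S. a i \<in> L)" if L: "ideal L R" for L
  proof -
    have "PIdl (a i) \<subseteq> L \<longleftrightarrow> a i \<in> L" if "i \<in> S" for i
      using cgenideal_self[OF assms(2)[OF that]] cgenideal_minimal[OF L] by blast
    then show ?thesis
      unfolding s_def by (subst ideals_sum(2)[OF assms(1) P L]) auto
  qed
  have carr: "L \<subseteq> carrier R" if "ideal L R" for L
    using additive_subgroup.a_subset ideal.axioms(1) that by blast
  show ?thesis
    unfolding s_def[symmetric] using sub s carr by blast
qed

lemma maximalideal_contains_factor:
  assumes M: "maximalideal M R" and "finite S" "\<And>i. i \<in> S \<Longrightarrow> ideal (Q i) R"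
    "(\<Otimes>\<^bsub>ideals_set R\<^esub>i\<in>S. Q i) \<subseteq> M"
  shows "\<exists>i\<in>S. Q i \<subseteq> M"
  using assms(2-)
proof (induction S)
  case empty
  interpret S: comm_monoid "ideals_set R" by (rule ideals_set_is_comm_monoid)
  show ?case using empty maximalideal_one[OF M] by auto
next
  case (insert i S)
  interpret S: comm_monoid "ideals_set R" by (rule ideals_set_is_comm_monoid)
  have "ideal (\<Otimes>\<^bsub>ideals_set R\<^esub>i\<in>S. Q i) R"
    using S.finprod_closed[of Q S] insert.prems by auto
  moreover have "Q i \<cdot> (\<Otimes>\<^bsub>ideals_set R\<^esub>i\<in>S. Q i) \<subseteq> M"
    using insert by (subst (asm) S.finprod_insert) auto
  ultimately have "Q i \<subseteq> M \<or> (\<Otimes>\<^bsub>ideals_set R\<^esub>i\<in>S. Q i) \<subseteq> M"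
    using primeideal_divides_ideal_prod[OF maximalideal_prime[OF M]] insert.prems by auto
  then show ?case using insert by auto
qed

lemma ideal_radical_subset:
  assumes M: "maximalideal M R" and Q: "Q \<subseteq> M"
  shows "ideal_radical R Q \<subseteq> M"
proof
  fix x assume "x \<in> ideal_radical R Q"
  then obtain j :: nat where x: "x \<in> carrier R" "x [^] j \<in> M" using Q by (auto simp: ideal_radical_def)
  interpret M: primeideal M R using maximalideal_prime[OF M] .
  have "x \<in> M" if "x [^] j \<in> M" for j :: nat
    using that
  proof (induction j)
    case 0 then show ?case using maximalideal_one[OF M] by simp
  next
    case (Suc j) then show ?case using M.I_prime[of "x [^] j" x] x by auto
  qed
  then show "x \<in> M" using x by blast
qed

end

section \<open>Column reduction modulo comaximal ideals\<close>

context cring begin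

lemma coset_add_cong:
  assumes "ideal J R" "J +> a = J +> a'" "J +> b = J +> b'"
    "a \<in> carrier R" "a' \<in> carrier R" "b \<in> carrier R" "b' \<in> carrier R"
  shows "J +> a \<oplus> b = J +> a' \<oplus> b'"
proof -
  interpret J: ideal J R by fact
  show ?thesis using J.a_rcos_sum[of a b] J.a_rcos_sum[of a' b'] assms by simp
qed

lemma coset_mult_cong:
  assumes "ideal J R" "J +> a = J +> a'" "J +> b = J +> b'"
    "a \<in> carrier R" "a' \<in> carrier R" "b \<in> carrier R" "b' \<in> carrier R"
  shows "J +> a \<otimes> b = J +> a' \<otimes> b'"
proof -
  interpret J: ideal J R by fact
  show ?thesis using J.rcoset_mult_add[of a b] J.rcoset_mult_add[of a' b'] assms by simp
qed

end

locale comaximal_ideals = cring R for R (structure) +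
  fixes n :: nat and I :: "nat \<Rightarrow> 'a set"
  assumes ideal: "r < n \<Longrightarrow> ideal (I r) R"
    and comaximal: "r < n \<Longrightarrow> s < n \<Longrightarrow> r \<noteq> s \<Longrightarrow> comaximal R (I r) (I s)"
begin

definition row_cong :: "(nat \<Rightarrow> nat \<Rightarrow> 'a) \<Rightarrow> (nat \<Rightarrow> nat \<Rightarrow> 'a) \<Rightarrow> bool" where
  "row_cong A B \<longleftrightarrow> (\<forall>r<n. \<forall>c<n. I r +> A r c = I r +> B r c)"

text \<open>
  Passing to a congruent matrix is built into the relation, so that a reduction can be carried out
  modulo the ideals throughout. The determinant is therefore not invariant under the relation; what
  survives is \<open>col_reachable_lift\<close>.
\<close>

inductive col_reachable :: "(nat \<Rightarrow> nat \<Rightarrow> 'a) \<Rightarrow> (nat \<Rightarrow> nat \<Rightarrow> 'a) \<Rightarrow> bool" where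
  start: "square_matrix R n A \<Longrightarrow> col_reachable A A"
| col_add: "col_reachable A B \<Longrightarrow> p < n \<Longrightarrow> q < n \<Longrightarrow> p \<noteq> q \<Longrightarrow> x \<in> carrier R \<Longrightarrow>
    col_reachable A (col_add R p q x B)"
| row_cong: "col_reachable A B \<Longrightarrow> square_matrix R n C \<Longrightarrow> row_cong B C \<Longrightarrow> col_reachable A C"

lemma col_reachable_square:
  assumes "col_reachable A B"
  shows "square_matrix R n A" "square_matrix R n B"
  using assms by (induction) (auto intro: square_matrix_col_add)

lemma row_cong_sym: "row_cong A B \<Longrightarrow> row_cong B A"
  by (simp add: row_cong_def)

lemma row_cong_trans: "row_cong A B \<Longrightarrow> row_cong B C \<Longrightarrow> row_cong A C"
  by (simp add: row_cong_def)

lemma row_cong_col_add: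
  assumes "row_cong A B" "square_matrix R n A" "square_matrix R n B"
    "p < n" "q < n" "x \<in> carrier R"
  shows "row_cong (col_add R p q x A) (col_add R p q x B)"
  unfolding row_cong_def
proof (intro allI impI)
  fix r c assume rc: "r < n" "c < n"
  have eq: "I r +> A r d = I r +> B r d" if "d < n" for d
    using assms(1) rc(1) that by (simp add: row_cong_def)
  have "I r +> A r q \<oplus> x \<otimes> A r p = I r +> B r q \<oplus> x \<otimes> B r p"
    using assms rc ideal[OF rc(1)] eq by (intro coset_add_cong coset_mult_cong) auto
  then show "I r +> col_add R p q x A r c = I r +> col_add R p q x B r c"
    using eq rc by (simp add: col_add_def)
qed

lemma col_reachable_trans:
  assumes "col_reachable B C" "col_reachable A B"
  shows "col_reachable A C"
  using assms by (induction) (auto intro: col_reachable.intros)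

lemma col_reachable_sym:
  assumes "col_reachable A B"
  shows "col_reachable B A"
  using assms
proof (induction)
  case (start A) then show ?case by (rule col_reachable.start)
next
  case (col_add A B p q x)
  have B: "square_matrix R n B" using col_reachable_square col_add by blast
  let ?C = "col_add R p q x B"
  have C: "square_matrix R n ?C" using B col_add by (intro square_matrix_col_add)
  have "col_reachable ?C (col_add R p q (\<ominus> x) ?C)"
    by (intro col_reachable.col_add col_reachable.start[OF C] col_add a_inv_closed)
  moreover have "row_cong (col_add R p q (\<ominus> x) ?C) B"
  proof -
    have "(a \<oplus> x \<otimes> b) \<oplus> \<ominus> x \<otimes> b = a" if "a \<in> carrier R" "b \<in> carrier R" for a b
      using that col_add(5) by algebra
    then show ?thesis using B col_add by (auto simp: row_cong_def col_add_def)
  qed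
  ultimately have "col_reachable ?C B" using col_reachable.row_cong[OF _ B] by blast
  then show ?case using col_add.IH by (rule col_reachable_trans[rotated])
next
  case (row_cong A B C)
  have "square_matrix R n B" using col_reachable_square row_cong by blast
  then have "col_reachable C B" using row_cong row_cong_sym col_reachable.start col_reachable.row_cong by blast
  then show ?case using row_cong.IH by (rule col_reachable_trans[rotated])
qed

text \<open>
  Column operations respect \<open>row_cong\<close>, so those leading from \<open>A\<close> to \<open>B\<close> can be replayed on \<open>A\<close> without
  the intermediate changes of representatives; the determinant is then that of \<open>A\<close>.
\<close>

lemma col_reachable_lift:
  assumes "col_reachable A B"
  shows "\<exists>C. square_matrix R n C \<and> row_cong C B \<and> determinant R n C = determinant R n A"
  using assms
proof (induction)
  case (start A) then show ?case by (intro exI[of _ A]) (simp add: row_cong_def)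
next
  case (col_add A B p q x)
  then obtain C where C: "square_matrix R n C" "row_cong C B"
    "determinant R n C = determinant R n A" by blast
  have "square_matrix R n B" using col_reachable_square col_add by blast
  then show ?case
    using C col_add square_matrix_col_add row_cong_col_add determinant_col_add
    by (intro exI[of _ "col_add R p q x C"]) auto
next
  case (row_cong A B C)
  then show ?case using row_cong_trans by blast
qed

text \<open>
  A column operation on a single row. It is realised by the column operation on all rows with
  multiplier \<open>e \<otimes> x\<close>, where \<open>e\<close> is \<open>\<one>\<close> modulo \<open>I r\<close> and belongs to the other ideals. The new entry \<open>y\<close>
  is any representative of its class, which lets later steps enter exact zeros and ones.
\<close>

lemma col_reachable_row_add:
  assumes AB: "col_reachable A (B(r := v))" and r: "r < n" and pq: "p < n" "q < n" "p \<noteq> q"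
    and x: "x \<in> carrier R" and y: "y \<in> carrier R" "I r +> y = I r +> v q \<oplus> x \<otimes> v p"
  shows "col_reachable A (B(r := v(q := y)))"
proof -
  have B: "square_matrix R n (B(r := v))" using col_reachable_square AB by blast
  have v: "v c \<in> carrier R" if "c < n" for c using square_matrixD[OF B r that] by simp
  have Bs: "B s c \<in> carrier R" if "c < n" "s < n" "s \<noteq> r" for s c
    using square_matrixD[OF B that(2,1)] that(3) by simp
  have Ir: "ideal (I r) R" using ideal r .
  obtain e where e: "e \<in> carrier R" "I r +> e = I r +> \<one>" "\<And>s. s < n \<Longrightarrow> s \<noteq> r \<Longrightarrow> e \<in> I s"
    using comaximal_separate[OF Ir, of "{..<n} - {r}" I] ideal comaximal[OF r] by auto
  have "col_reachable A (col_add R p q (e \<otimes> x) (B(r := v)))"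
    using AB pq e(1) x by (intro col_reachable.col_add) auto
  moreover have "square_matrix R n (B(r := v(q := y)))"
    using v Bs y by (auto simp: square_matrix_def)
  moreover have "row_cong (col_add R p q (e \<otimes> x) (B(r := v))) (B(r := v(q := y)))"
    unfolding row_cong_def
  proof (intro allI impI)
    fix s c assume s: "s < n" and c: "c < n"
    consider "c \<noteq> q" | "c = q" "s = r" | "c = q" "s \<noteq> r" by blast
    then show "I s +> col_add R p q (e \<otimes> x) (B(r := v)) s c = I s +> (B(r := v(q := y))) s c"
    proof cases
      case 1 then show ?thesis by (simp add: col_add_def)
    next
      case 2
      have "I r +> e \<otimes> x \<otimes> v p = I r +> \<one> \<otimes> x \<otimes> v p"
        using Ir e x v pq by (intro coset_mult_cong) auto
      then have "I r +> v q \<oplus> e \<otimes> x \<otimes> v p = I r +> v q \<oplus> x \<otimes> v p"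
        using Ir e x v pq by (intro coset_add_cong) auto
      then show ?thesis using 2 y by (simp add: col_add_def)
    next
      case 3
      have Is: "ideal (I s) R" using ideal s .
      have "e \<otimes> x \<otimes> B s p \<in> I s"
        using e(3)[OF s] 3 x Bs[OF pq(1) s] ideal.I_r_closed[OF Is] by blast
      then have "I s +> e \<otimes> x \<otimes> B s p = I s +> \<zero>"
        using quotient_eq_iff_same_a_r_cos[OF Is, of "e \<otimes> x \<otimes> B s p" \<zero>] e x Bs[OF pq(1) s] 3
        by (simp add: a_minus_def)
      then have "I s +> B s q \<oplus> e \<otimes> x \<otimes> B s p = I s +> B s q \<oplus> \<zero>"
        using Is e x Bs pq s 3 by (intro coset_add_cong) auto
      then show ?thesis using 3 Bs[OF pq(2) s] by (simp add: col_add_def)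
    qed
  qed
  ultimately show ?thesis by (rule col_reachable.row_cong)
qed

text \<open>
  Repeated use of \<open>semilocal_stable_range\<close> makes entry \<open>p\<close> generate, modulo the intersection of \<open>T\<close>,
  the ideal of all entries at \<open>insert p S\<close>.
\<close>

lemma col_reachable_row_gather:
  assumes AB: "col_reachable A (B(r := v))" and r: "r < n" and p: "p < n"
    and S: "S \<subseteq> {..<n} - {p}"
    and T: "finite T" "\<And>M. M \<in> T \<Longrightarrow> maximalideal M R"
  shows "\<exists>u\<in>carrier R. col_reachable A (B(r := v(p := u))) \<and>
    (\<forall>M\<in>T. u \<in> M \<longleftrightarrow> v p \<in> M \<and> (\<forall>c\<in>S. v c \<in> M))"
proof -
  have v: "v c \<in> carrier R" if "c < n" for c
    using square_matrixD[OF col_reachable_square(2)[OF AB] r that] by simp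
  have "finite S" using S finite_subset by blast
  then show ?thesis
    using S
  proof (induction S)
    case empty
    have "col_reachable A (B(r := v(p := v p)))" using AB by (simp only: fun_upd_triv)
    then show ?case using v[OF p] by blast
  next
    case (insert c S)
    then obtain u where u: "u \<in> carrier R" "col_reachable A (B(r := v(p := u)))"
      "\<forall>M\<in>T. u \<in> M \<longleftrightarrow> v p \<in> M \<and> (\<forall>c\<in>S. v c \<in> M)" by blast
    have c: "c < n" "c \<noteq> p" using insert.prems by auto
    obtain x where x: "x \<in> carrier R" "\<forall>M\<in>T. u \<oplus> x \<otimes> v c \<in> M \<longleftrightarrow> u \<in> M \<and> v c \<in> M"
      using semilocal_stable_range[OF T u(1) v[OF c(1)]] by blast
    have "col_reachable A (B(r := (v(p := u))(p := u \<oplus> x \<otimes> v c)))"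
      by (rule col_reachable_row_add[OF u(2) r c(1) p c(2) x(1)]) (use u x v c in auto)
    then have "col_reachable A (B(r := v(p := u \<oplus> x \<otimes> v c)))" by (simp only: fun_upd_upd)
    moreover have "u \<oplus> x \<otimes> v c \<in> carrier R" using u(1) x(1) v[OF c(1)] by simp
    moreover have "\<forall>M\<in>T. u \<oplus> x \<otimes> v c \<in> M \<longleftrightarrow> v p \<in> M \<and> (\<forall>d\<in>insert c S. v d \<in> M)"
      using u(3) x(2) by blast
    ultimately show ?case by blast
  qed
qed

lemma col_reachable_row_clear:
  assumes AB: "col_reachable A (B(r := v))" and r: "r < n" and p: "p < n" "I r +> v p = I r +> \<one>"
    and S: "S \<subseteq> {..<n} - {p}"
  shows "col_reachable A (B(r := (\<lambda>c. if c \<in> S then \<zero> else v c)))"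
proof -
  have v: "v c \<in> carrier R" if "c < n" for c
    using square_matrixD[OF col_reachable_square(2)[OF AB] r that] by simp
  have Ir: "ideal (I r) R" using ideal r .
  have "finite S" using S finite_subset by blast
  then show ?thesis
    using S
  proof (induction S)
    case empty then show ?case using AB by (simp only: empty_iff if_False)
  next
    case (insert c S)
    let ?w = "\<lambda>c. if c \<in> S then \<zero> else v c"
    have w: "col_reachable A (B(r := ?w))" using insert.IH insert.prems by blast
    have c: "c < n" "c \<noteq> p" and pS: "p \<notin> S" using insert.prems by auto
    have "I r +> \<ominus> v c \<otimes> v p = I r +> \<ominus> v c \<otimes> \<one>"
      using Ir v c p by (intro coset_mult_cong) auto
    then have "I r +> v c \<oplus> \<ominus> v c \<otimes> v p = I r +> v c \<oplus> \<ominus> v c \<otimes> \<one>"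
      using Ir v c p by (intro coset_add_cong) auto
    then have "I r +> \<zero> = I r +> v c \<oplus> \<ominus> v c \<otimes> v p"
      using v[OF c(1)] by (simp add: r_neg)
    then have "col_reachable A (B(r := ?w(c := \<zero>)))"
      by (intro col_reachable_row_add[OF w r p(1) c(1) c(2)[symmetric], of "\<ominus> v c"])
        (use v[OF c(1)] pS insert.hyps(2) in auto)
    moreover have "?w(c := \<zero>) = (\<lambda>d. if d \<in> insert c S then \<zero> else v d)" by auto
    ultimately show ?case by (simp only:)
  qed
qed

text \<open>
  First the diagonal entry is made a unit \<open>u\<close> modulo \<open>I r\<close>. A unit can then be traded for \<open>\<one>\<close> with the
  help of a second column \<open>j\<close>: a multiple of \<open>u\<close> turns entry \<open>j\<close> into \<open>\<one>\<close>, and a multiple of this \<open>\<one>\<close>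
  turns the diagonal entry into \<open>\<one>\<close>. This is where \<open>2 \<le> n\<close> enters.
\<close>

lemma col_reachable_unit_row:
  assumes AB: "col_reachable A (B(r := v))" and r: "r < n" and n: "2 \<le> n"
    and fin: "finite {M. maximalideal M R \<and> I r \<subseteq> M}"
    and v: "\<And>M. maximalideal M R \<Longrightarrow> \<exists>c<n. v c \<notin> M"
  shows "col_reachable A (B(r := unit_matrix R r))"
proof -
  have vc: "v c \<in> carrier R" if "c < n" for c
    using square_matrixD[OF col_reachable_square(2)[OF AB] r that] by simp
  have Ir: "ideal (I r) R" using ideal r .
  obtain j where j: "j < n" "j \<noteq> r" using n r
    by (metis One_nat_def Suc_1 Suc_le_lessD less_trans zero_less_Suc zero_neq_one)
  obtain u where u: "u \<in> carrier R" "col_reachable A (B(r := v(r := u)))"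
    "\<And>M. maximalideal M R \<Longrightarrow> I r \<subseteq> M \<Longrightarrow> u \<in> M \<longleftrightarrow> v r \<in> M \<and> (\<forall>c\<in>{..<n} - {r}. v c \<in> M)"
  proof -
    have "\<exists>u\<in>carrier R. col_reachable A (B(r := v(r := u))) \<and>
        (\<forall>M\<in>{M. maximalideal M R \<and> I r \<subseteq> M}.
          u \<in> M \<longleftrightarrow> v r \<in> M \<and> (\<forall>c\<in>{..<n} - {r}. v c \<in> M))"
      by (rule col_reachable_row_gather[OF AB r r order_refl fin]) simp
    then obtain u where "u \<in> carrier R" "col_reachable A (B(r := v(r := u)))"
      "\<forall>M\<in>{M. maximalideal M R \<and> I r \<subseteq> M}.
          u \<in> M \<longleftrightarrow> v r \<in> M \<and> (\<forall>c\<in>{..<n} - {r}. v c \<in> M)" by (elim bexE conjE)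
    then show ?thesis by (intro that[of u]) simp_all
  qed
  have "\<exists>w\<in>carrier R. I r +> w \<otimes> u = I r +> \<one>"
  proof (rule unit_mod_ideal[OF Ir u(1)])
    fix M assume M: "maximalideal M R" "I r \<subseteq> M"
    show "u \<notin> M" using u(3)[OF M] v[OF M(1)] by auto
  qed
  then obtain w where w: "w \<in> carrier R" "I r +> w \<otimes> u = I r +> \<one>" by blast
  have "I r +> v j \<oplus> (\<one> \<ominus> v j) \<otimes> w \<otimes> u = I r +> \<one>"
  proof -
    have "I r +> (\<one> \<ominus> v j) \<otimes> (w \<otimes> u) = I r +> (\<one> \<ominus> v j) \<otimes> \<one>"
      using Ir w u vc[OF j(1)] by (intro coset_mult_cong) auto
    then have "I r +> v j \<oplus> (\<one> \<ominus> v j) \<otimes> (w \<otimes> u) = I r +> v j \<oplus> (\<one> \<ominus> v j) \<otimes> \<one>"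
      using Ir w u vc[OF j(1)] by (intro coset_add_cong) auto
    moreover have "v j \<oplus> (\<one> \<ominus> v j) \<otimes> \<one> = \<one>" using vc[OF j(1)] by algebra
    ultimately show ?thesis using w u vc[OF j(1)] by (simp add: m_assoc)
  qed
  then have 1: "col_reachable A (B(r := v(r := u, j := \<one>)))"
    by (intro col_reachable_row_add[OF u(2) r r j(1) j(2)[symmetric], of "(\<one> \<ominus> v j) \<otimes> w"])
      (use j w vc[OF j(1)] in auto)
  have "u \<oplus> (\<one> \<ominus> u) \<otimes> \<one> = \<one>" using u(1) by algebra
  then have 2: "col_reachable A (B(r := v(r := u, j := \<one>, r := \<one>)))"
    by (intro col_reachable_row_add[OF 1 r j(1) r j(2), of "\<one> \<ominus> u"]) (use j u(1) in auto)
  have 3: "col_reachable A (B(r := (\<lambda>c. if c \<in> {..<n} - {r} then \<zero> else (v(r := u, j := \<one>, r := \<one>)) c)))"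
    by (rule col_reachable_row_clear[OF 2 r r]) auto
  have "square_matrix R n (B(r := unit_matrix R r))"
    using col_reachable_square(2)[OF AB] by (auto simp: square_matrix_def unit_matrix_def)
  with 3 show ?thesis
    by (rule col_reachable.row_cong) (auto simp: row_cong_def unit_matrix_def)
qed

lemma col_reachable_unit_matrix:
  assumes B: "square_matrix R n B" and n: "2 \<le> n"
    and fin: "\<And>r. r < n \<Longrightarrow> finite {M. maximalideal M R \<and> I r \<subseteq> M}"
    and v: "\<And>r M. r < n \<Longrightarrow> maximalideal M R \<Longrightarrow> \<exists>c<n. B r c \<notin> M"
  shows "col_reachable B (unit_matrix R)"
proof -
  have "col_reachable B (\<lambda>r. if r < m then unit_matrix R r else B r)" if "m \<le> n" for m
    using that
  proof (induction m)
    case 0 then show ?case using col_reachable.start[OF B] by simp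
  next
    case (Suc m)
    let ?C = "\<lambda>r. if r < m then unit_matrix R r else B r"
    have "?C = ?C(m := B m)" by auto
    moreover have "col_reachable B ?C" using Suc by simp
    ultimately have "col_reachable B (?C(m := B m))" by (simp only:)
    then have "col_reachable B (?C(m := unit_matrix R m))"
      by (rule col_reachable_unit_row) (use Suc n fin v in auto)
    moreover have "?C(m := unit_matrix R m) = (\<lambda>r. if r < Suc m then unit_matrix R r else B r)"
      by (auto simp: fun_eq_iff less_Suc_eq)
    ultimately show ?case by (simp only:)
  qed
  then have "col_reachable B (\<lambda>r. if r < n then unit_matrix R r else B r)" by simp
  then show ?thesis
    by (rule col_reachable.row_cong) (auto simp: square_matrix_def unit_matrix_def row_cong_def)
qed

text \<open>
  Reachability is symmetric, so \<open>B\<close> is also reachable from the identity matrix, and lifting this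
  yields a matrix with the determinant of the identity.
\<close>

theorem exists_determinant_one_lift:
  assumes "square_matrix R n B" "2 \<le> n"
    and "\<And>r. r < n \<Longrightarrow> finite {M. maximalideal M R \<and> I r \<subseteq> M}"
    and "\<And>r M. r < n \<Longrightarrow> maximalideal M R \<Longrightarrow> \<exists>c<n. B r c \<notin> M"
  shows "\<exists>C. square_matrix R n C \<and> determinant R n C = \<one> \<and>
    (\<forall>r<n. \<forall>c<n. I r +> C r c = I r +> B r c)"
  using col_reachable_lift[OF col_reachable_sym[OF col_reachable_unit_matrix[OF assms]]] determinant_unit_matrix
  by (auto simp: row_cong_def)

end

section \<open>Surjectivity onto the product of projective spaces\<close>

context cring begin

text \<open>
  Each Leibniz term contains a factor from row \<open>r\<close>.
\<close>

lemma determinant_in_ideal: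
  assumes A: "square_matrix R n A" and L: "ideal L R" and r: "r < n"
    and row: "\<And>c. c < n \<Longrightarrow> A r c \<in> L"
  shows "determinant R n A \<in> L"
proof -
  interpret L: ideal L R by fact
  have sum: "(\<Oplus>i\<in>S. f i) \<in> L" if "finite S" "\<And>i. i \<in> S \<Longrightarrow> f i \<in> L" for S :: "(nat \<Rightarrow> nat) set" and f
    using that
  proof (induction S)
    case (insert i S)
    then show ?case by (subst finsum_insert) (auto intro: L.Icarr)
  qed simp
  have prod: "(\<Otimes>i\<in>{..<n}. A i (\<pi> i)) \<in> L" if s: "\<pi> permutes {..<n}" for \<pi>
  proof -
    define N where "N = {..<n} - {r}"
    have n: "{..<n} = insert r N" and N: "finite N" "r \<notin> N" "\<And>i. i \<in> N \<Longrightarrow> i < n"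
      using r by (auto simp: N_def)
    have "A r (\<pi> r) \<in> L" using row permutes_in_image[OF s, of r] r by simp
    moreover have "(\<Otimes>i\<in>N. A i (\<pi> i)) \<in> carrier R"
      using square_matrix_perm[OF A s] N(3) by (intro finprod_closed) auto
    ultimately have "A r (\<pi> r) \<otimes> (\<Otimes>i\<in>N. A i (\<pi> i)) \<in> L"
      by (rule L.I_r_closed)
    then show ?thesis
      unfolding n using N square_matrix_perm[OF A s] r by (subst finprod_insert) auto
  qed
  show ?thesis
    unfolding determinant_def by (rule sum) (use prod in \<open>auto simp: finite_permutations\<close>)
qed

lemma GCD_tuples_iff:
  "a \<in> GCD_tuples R n \<longleftrightarrow> a \<in> {..<n} \<rightarrow>\<^sub>E carrier R \<and>
    (\<forall>L. ideal L R \<longrightarrow> (\<forall>c<n. a c \<in> L) \<longrightarrow> L = carrier R)"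
proof (cases "a \<in> {..<n} \<rightarrow>\<^sub>E carrier R")
  case True
  then have "a c \<in> carrier R" if "c \<in> {..<n}" for c using that by blast
  then have "(\<Oplus>\<^bsub>ideals_set R\<^esub>i\<in>{..<n}. PIdl (a i)) = carrier R \<longleftrightarrow>
      (\<forall>L. ideal L R \<longrightarrow> (\<forall>c<n. a c \<in> L) \<longrightarrow> L = carrier R)"
    unfolding Ball_def lessThan_iff[symmetric] by (rule unimodular_iff[unfolded Ball_def, OF finite_lessThan])
  then show ?thesis using True by (simp only: GCD_tuples_def mem_Collect_eq simp_thms)
qed (simp add: GCD_tuples_def)

lemma SL_row_GCD:
  assumes A: "A \<in> SL R n" and r: "r < n"
  shows "A r \<in> GCD_tuples R n"
  unfolding GCD_tuples_iff
proof (intro conjI allI impI)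
  show "A r \<in> {..<n} \<rightarrow>\<^sub>E carrier R" using A r by (auto simp: SL_def)
  have sq: "square_matrix R n A" using A by (auto simp: SL_def square_matrix_def PiE_iff)
  fix L assume L: "ideal L R" "\<forall>c<n. A r c \<in> L"
  have "determinant R n A \<in> L" using determinant_in_ideal[OF sq L(1) r] L(2) by blast
  then show "L = carrier R" using A ideal.one_imp_carrier[OF L(1)] by (simp add: SL_def)
qed

text \<open>
  Congruent tuples are related to the same tuples with the same scalar \<open>l\<close>, so their
  classes agree.
\<close>

lemma PF_class_eq:
  assumes J: "ideal J R" and a: "a \<in> GCD_tuples R (k + 1)" and b: "b \<in> GCD_tuples R (k + 1)"
    and ab: "\<And>c. c \<le> k \<Longrightarrow> J +> a c = J +> b c"
  shows "PF_class R k \<mu> J a = PF_class R k \<mu> J b"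
proof -
  have carr: "d c \<in> carrier R" if "d \<in> GCD_tuples R (k + 1)" "c \<le> k" for d c
    using that unfolding GCD_tuples_iff by auto
  have "a c \<ominus> l [^] \<mu> c \<otimes> d c \<in> J \<longleftrightarrow> b c \<ominus> l [^] \<mu> c \<otimes> d c \<in> J"
    if "d \<in> GCD_tuples R (k + 1)" "c \<le> k" "l \<in> carrier R" for d c l
    using quotient_eq_iff_same_a_r_cos[OF J] carr[OF a] carr[OF b] carr[OF that(1)] that ab by simp
  then have "(a, d) \<in> PF_rel R k \<mu> J \<longleftrightarrow> (b, d) \<in> PF_rel R k \<mu> J" for d
    using a b unfolding PF_rel_def by blast
  then show ?thesis by (auto simp: PF_class_def)
qed

lemma SL_to_PF_image:
  assumes k: "k \<ge> 1" and I: "\<And>i. i \<le> k \<Longrightarrow> ideal (I i) R"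
    and comax: "\<And>i j. i \<le> k \<Longrightarrow> j \<le> k \<Longrightarrow> i \<noteq> j \<Longrightarrow> comaximal R (I i) (I j)"
    and fin: "\<And>i. i \<le> k \<Longrightarrow> finite {M. maximalideal M R \<and> I i \<subseteq> M}"
  shows "SL_to_PF R k m I ` SL R (k + 1) = (\<Pi>\<^sub>E i\<in>{..k}. PF R k (m i) (I i))"
proof (intro equalityI subsetI)
  fix f assume "f \<in> SL_to_PF R k m I ` SL R (k + 1)"
  then obtain A where "A \<in> SL R (k + 1)" "f = (\<lambda>i\<in>{..k}. PF_class R k (m i) (I i) (A i))"
    by (auto simp: SL_to_PF_def)
  then show "f \<in> (\<Pi>\<^sub>E i\<in>{..k}. PF R k (m i) (I i))"
    using SL_row_GCD[of A "k + 1"] by (auto simp: PF_def PF_class_def intro!: quotientI)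
next
  interpret comaximal_ideals R "k + 1" I
    by (intro comaximal_ideals.intro comaximal_ideals_axioms.intro cring_axioms I comax) simp_all
  fix f assume f: "f \<in> (\<Pi>\<^sub>E i\<in>{..k}. PF R k (m i) (I i))"
  then have "\<forall>i\<in>{..k}. \<exists>b\<in>GCD_tuples R (k + 1). f i = PF_class R k (m i) (I i) b"
    by (auto simp: PF_def PF_class_def quotient_def PiE_iff)
  then obtain B where B: "\<And>i. i \<le> k \<Longrightarrow> B i \<in> GCD_tuples R (k + 1)"
    "\<And>i. i \<le> k \<Longrightarrow> f i = PF_class R k (m i) (I i) (B i)"
    by (metis atMost_iff)
  have "B r c \<in> carrier R" if "r < k + 1" "c < k + 1" for r c
    using B(1)[of r] that unfolding GCD_tuples_iff by (auto simp: PiE_iff)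
  then have "square_matrix R (k + 1) B" by (simp add: square_matrix_def)
  moreover have "\<exists>c<k + 1. B r c \<notin> M" if "r < k + 1" "maximalideal M R" for r M
    using B(1)[of r] that maximalideal.axioms(1)[OF that(2)] maximalideal.I_notcarr[OF that(2)]
    unfolding GCD_tuples_iff by auto
  ultimately obtain C where C: "square_matrix R (k + 1) C" "determinant R (k + 1) C = \<one>"
    "\<forall>r<k + 1. \<forall>c<k + 1. I r +> C r c = I r +> B r c"
    using exists_determinant_one_lift[of B] k fin by auto
  define A where "A = (\<lambda>r\<in>{..<k + 1}. \<lambda>c\<in>{..<k + 1}. C r c)"
  have "determinant R (k + 1) A = \<one>"
    using determinant_cong[of "k + 1" A C] C by (simp add: A_def)
  then have A: "A \<in> SL R (k + 1)" using C(1) by (auto simp: SL_def A_def)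
  have "PF_class R k (m i) (I i) (A i) = f i" if i: "i \<le> k" for i
    unfolding B(2)[OF i]
    by (rule PF_class_eq[OF I[OF i] _ B(1)[OF i]]) (use SL_row_GCD[OF A, of i] C(3) i in \<open>auto simp: A_def\<close>)
  then have "SL_to_PF R k m I A = f"
    using A f by (auto simp: SL_to_PF_def fun_eq_iff PiE_iff extensional_def)
  then show "f \<in> SL_to_PF R k m I ` SL R (k + 1)" using A by blast
qed

text \<open>
  If \<open>\<one> = x \<oplus> y\<close> with \<open>x \<in> J\<close> and \<open>y \<in> K\<close>, then \<open>x\<close> avoids any maximal ideal over \<open>K\<close>, so \<open>x\<close> is not in the
  Jacobson radical; every maximal ideal over \<open>J\<close> contains \<open>x\<close>.
\<close>

lemma finite_maximalideals_over_comaximal: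
  assumes fin: "\<And>x. x \<in> carrier R \<Longrightarrow> x \<notin> jacobson_radical R \<Longrightarrow>
      finite {M. maximalideal M R \<and> x \<in> M}"
    and J: "ideal J R" and K: "ideal K R" "K \<noteq> carrier R" and JK: "comaximal R J K"
  shows "finite {M. maximalideal M R \<and> J \<subseteq> M}"
proof -
  interpret J: ideal J R by fact
  obtain N where N: "maximalideal N R" "K \<subseteq> N" using exists_maximalideal[OF K] by blast
  interpret N: maximalideal N R by fact
  have "J <+>\<^bsub>R\<^esub> K = carrier R" using JK by (simp add: comaximal_def)
  then obtain x y where xy: "x \<in> J" "y \<in> K" "\<one> = x \<oplus> y"
    using one_closed unfolding set_add_def' by blast
  have "x \<notin> N"
    using xy N maximalideal_one[OF N(1)] N.a_closed[of x y] by auto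
  then have "x \<notin> jacobson_radical R" using N(1) by (auto simp: jacobson_radical_def)
  then have "finite {M. maximalideal M R \<and> x \<in> M}" using fin J.Icarr xy(1) by blast
  then show ?thesis by (rule finite_subset[rotated]) (use xy(1) in auto)
qed

text \<open>
  A maximal ideal over the product contains some factor by primality, hence the radical of that
  factor, and equals it by maximality.
\<close>

lemma finite_maximalideals_over_product:
  assumes S: "finite S" and Q: "\<And>j. j \<in> S \<Longrightarrow> ideal (Q j) R"
    and M: "\<And>j. j \<in> S \<Longrightarrow> maximalideal (ideal_radical R (Q j)) R"
  shows "finite {M. maximalideal M R \<and> (\<Otimes>\<^bsub>ideals_set R\<^esub>j\<in>S. Q j) \<subseteq> M}"
proof (rule finite_subset)
  show "{M. maximalideal M R \<and> (\<Otimes>\<^bsub>ideals_set R\<^esub>j\<in>S. Q j) \<subseteq> M} \<subseteq> (\<lambda>j. ideal_radical R (Q j)) ` S"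
  proof (intro subsetI, elim CollectE conjE)
    fix N assume N: "maximalideal N R" "(\<Otimes>\<^bsub>ideals_set R\<^esub>j\<in>S. Q j) \<subseteq> N"
    obtain j where j: "j \<in> S" "Q j \<subseteq> N"
      using maximalideal_contains_factor[OF N(1) S Q N(2)] by blast
    interpret N: maximalideal N R by fact
    have "N = ideal_radical R (Q j) \<or> N = carrier R"
      using maximalideal.I_maximal[OF M[OF j(1)] N.is_ideal ideal_radical_subset[OF N(1) j(2)]]
        N.a_subset by blast
    then show "N \<in> (\<lambda>j. ideal_radical R (Q j)) ` S" using N.I_notcarr j(1) by auto
  qed
qed (use S in simp)

lemma no_maximalideal_over_carrier: "{M. maximalideal M R \<and> carrier R \<subseteq> M} = {}"
  using maximalideal_one by blast

end

theorem mainTheorem2: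
  fixes R :: "('a, 'b) ring_scheme" (structure)
    and k :: nat
    and m :: "nat \<Rightarrow> nat \<Rightarrow> nat"
  assumes "cring R"
    and "\<And>x. x \<in> carrier R \<Longrightarrow> x \<notin> jacobson_radical R \<Longrightarrow> finite {M. maximalideal M R \<and> x \<in> M}"
    and "k \<ge> 1"
    and "\<And>i j. i \<le> k \<Longrightarrow> j \<le> k \<Longrightarrow> m i j \<ge> 1"
  shows
    "(\<forall>I :: nat \<Rightarrow> 'a set.
        (\<forall>i\<le>k. ideal (I i) R) \<longrightarrow>
        (\<forall>i\<le>k. \<forall>j\<le>k. i \<noteq> j \<longrightarrow> comaximal R (I i) (I j)) \<longrightarrow>
        (\<forall>i\<le>k. I i \<noteq> carrier R \<and> (\<forall>j\<le>k. j \<noteq> i \<longrightarrow> I j = carrier R) \<longrightarrow>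
           finite {M. maximalideal M R \<and> I i \<subseteq> M}) \<longrightarrow>
        SL_to_PF R k m I ` SL R (k + 1) = (\<Pi>\<^sub>E i\<in>{..k}. PF R k (m i) (I i)))
     \<and>
     (\<forall>(I :: nat \<Rightarrow> 'a set) (r :: nat \<Rightarrow> nat) (Q :: nat \<Rightarrow> nat \<Rightarrow> 'a set) (M :: nat \<Rightarrow> nat \<Rightarrow> 'a set).
        (\<forall>i\<le>k. ideal (I i) R) \<longrightarrow>
        (\<forall>i\<le>k. \<forall>j\<le>k. i \<noteq> j \<longrightarrow> comaximal R (I i) (I j)) \<longrightarrow>
        (\<forall>i\<le>k. I i = carrier R \<or>
           r i \<ge> 1 \<and>
           (\<forall>j\<in>{1..r i}. ideal (Q i j) R \<and> maximalideal (M i j) R \<and>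
              ideal_radical R (Q i j) = M i j) \<and>
           I i = (\<Otimes>\<^bsub>ideals_set R\<^esub>j\<in>{1..r i}. Q i j)) \<longrightarrow>
        inj_on (\<lambda>(i, j). M i j) (SIGMA i:{i. i \<le> k \<and> I i \<noteq> carrier R}. {1..r i}) \<longrightarrow>
        SL_to_PF R k m I ` SL R (k + 1) = (\<Pi>\<^sub>E i\<in>{..k}. PF R k (m i) (I i)))"
proof (intro conjI allI impI)
  interpret cring R by fact
  show "SL_to_PF R k m I ` SL R (k + 1) = (\<Pi>\<^sub>E i\<in>{..k}. PF R k (m i) (I i))"
    if I: "\<forall>i\<le>k. ideal (I i) R"
      and comax: "\<forall>i\<le>k. \<forall>j\<le>k. i \<noteq> j \<longrightarrow> comaximal R (I i) (I j)"
      and one: "\<forall>i\<le>k. I i \<noteq> carrier R \<and> (\<forall>j\<le>k. j \<noteq> i \<longrightarrow> I j = carrier R) \<longrightarrow>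
           finite {M. maximalideal M R \<and> I i \<subseteq> M}" for I
  proof (rule SL_to_PF_image[OF assms(3)])
    fix i assume i: "i \<le> k"
    consider "I i = carrier R" | "I i \<noteq> carrier R" "\<forall>j\<le>k. j \<noteq> i \<longrightarrow> I j = carrier R"
      | j where "j \<le> k" "j \<noteq> i" "I j \<noteq> carrier R" by blast
    then show "finite {M. maximalideal M R \<and> I i \<subseteq> M}"
    proof cases
      case 1 then show ?thesis by (simp only: no_maximalideal_over_carrier finite.emptyI)
    next
      case 2 then show ?thesis using one i by blast
    next
      case (3 j)
      then show ?thesis
        using finite_maximalideals_over_comaximal[OF assms(2), of "I i" "I j"] I comax i by auto
    qed
  qed (use I comax in auto)
  show "SL_to_PF R k m I ` SL R (k + 1) = (\<Pi>\<^sub>E i\<in>{..k}. PF R k (m i) (I i))"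
    if I: "\<forall>i\<le>k. ideal (I i) R"
      and comax: "\<forall>i\<le>k. \<forall>j\<le>k. i \<noteq> j \<longrightarrow> comaximal R (I i) (I j)"
      and prod: "\<forall>i\<le>k. I i = carrier R \<or>
           r i \<ge> 1 \<and>
           (\<forall>j\<in>{1..r i}. ideal (Q i j) R \<and> maximalideal (M i j) R \<and>
              ideal_radical R (Q i j) = M i j) \<and>
           I i = (\<Otimes>\<^bsub>ideals_set R\<^esub>j\<in>{1..r i}. Q i j)"
    for I and r :: "nat \<Rightarrow> nat" and Q M :: "nat \<Rightarrow> nat \<Rightarrow> 'a set"
  proof (rule SL_to_PF_image[OF assms(3)])
    fix i assume i: "i \<le> k"
    show "finite {M. maximalideal M R \<and> I i \<subseteq> M}"
    proof (cases "I i = carrier R")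
      case True then show ?thesis by (simp only: no_maximalideal_over_carrier finite.emptyI)
    next
      case False
      then have "\<forall>j\<in>{1..r i}. ideal (Q i j) R \<and> maximalideal (ideal_radical R (Q i j)) R"
        and eq: "I i = (\<Otimes>\<^bsub>ideals_set R\<^esub>j\<in>{1..r i}. Q i j)"
        using prod i by auto
      then show ?thesis
        unfolding eq by (intro finite_maximalideals_over_product) auto
    qed
  qed (use I comax in auto)
qed

end
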